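(* Let $f \in \mathrm{SL}(2,\mathbb{C})$ be loxodromic and let $x$ lie in the attracting basin of the attracting fixed point $p$ of $f$. Let $h \in \mathrm{PSL}(2,\mathbb{C})$ be a Möbius transformation such that $f = h^{-1} \circ g \circ h$, where $g(z) = \lambda z$ and $0<|\lambda|<1$. Then there exists a compact neighborhood $K$ of $x$ such that $$f^n|_K = h^{-1} \circ g^n \circ h|_K \longrightarrow p$$ uniformly on $K$ as $n \to \infty$.
   Context: $\widehat{\mathbb{C}} = \mathbb{C}\cup\{\infty\}$ is the Riemann sphere. A matrix $\begin{pmatrix} a&b\\c&d\end{pmatrix}\in \mathrm{SL}(2,\mathbb{C})$ acts on $\widehat{\mathbb{C}}$ by $z\mapsto \frac{az+b}{cz+d}$. Such an $f$ is loxodromic if it is conjugate to $z\mapsto\lambda z$ with $|\lambda|\ne 1$; it then has exactly two fixed points, one attracting ($|f'(p)|<1$, computed in a local coordinate if $p=\infty$) and one repelling. The attracting basin of $p$ is $\{x\in\widehat{\mathbb{C}} : f^n(x)\to p \text{ as } n\to\infty\}$, where $f^n$ is the $n$-th iterate. Uniform convergence is with respect to the chordal metric $d(z_1,z_2)=\frac{|z_1-z_2|}{\sqrt{(1+|z_1|^2)(1+|z_2|^2)}}$, $d(z,\infty)=(1+|z|^2)^{-1/2}$, and $p$ also denotes the constant map with value $p$. *)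

theory Defs
  imports "HOL-Analysis.Analysis" "HOL-Library.FuncSet"
begin

datatype csphere = Fin complex | Infty

fun chordal :: "csphere \<Rightarrow> csphere \<Rightarrow> real" where
  "chordal (Fin z) (Fin w) = cmod (z - w) / sqrt ((1 + (cmod z)\<^sup>2) * (1 + (cmod w)\<^sup>2))"
| "chordal (Fin z) Infty = 1 / sqrt (1 + (cmod z)\<^sup>2)"
| "chordal Infty (Fin w) = 1 / sqrt (1 + (cmod w)\<^sup>2)"
| "chordal Infty Infty = 0"

(* Stereographic projection onto the sphere of radius 1/2 centred at (0, 1/2); the chordal
   metric is the Euclidean distance of the images. *)
fun stereo :: "csphere \<Rightarrow> complex \<times> real" where
  "stereo (Fin z) = (z / complex_of_real (1 + (cmod z)\<^sup>2), (cmod z)\<^sup>2 / (1 + (cmod z)\<^sup>2))"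
| "stereo Infty = (0, 1)"

lemma chordal_eq_dist_stereo: "chordal x y = dist (stereo x) (stereo y)"
proof -
  have pos: "1 + (cmod z)\<^sup>2 > 0" for z
    by (simp add: add_pos_nonneg)
  have inf: "dist (stereo (Fin z)) (stereo Infty) = 1 / sqrt (1 + (cmod z)\<^sup>2)" for z
  proof -
    define s where "s = 1 + (cmod z)\<^sup>2"
    have s: "s > 0" "(cmod z)\<^sup>2 = s - 1" using pos[of z] by (auto simp: s_def)
    have 1: "(cmod (z / complex_of_real s))\<^sup>2 = (s - 1) / s\<^sup>2"
      using s by (simp add: norm_divide power_divide)
    have 2: "(dist ((s - 1) / s) 1)\<^sup>2 = 1 / s\<^sup>2"
      using s by (simp add: dist_real_def field_simps power2_eq_square)
    have st: "stereo (Fin z) = (z / complex_of_real s, (s - 1) / s)"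
      by (simp add: s(2))
    have "dist (stereo (Fin z)) (stereo Infty) = sqrt ((s - 1) / s\<^sup>2 + 1 / s\<^sup>2)"
      unfolding st stereo.simps(2) dist_Pair_Pair 2 by (simp only: dist_norm diff_0_right 1)
    also have "(s - 1) / s\<^sup>2 + 1 / s\<^sup>2 = 1 / s"
      using s(1) by (simp add: field_simps power2_eq_square)
    finally show ?thesis by (simp add: s_def real_sqrt_divide)
  qed
  have fin: "dist (stereo (Fin z)) (stereo (Fin w)) = chordal (Fin z) (Fin w)" for z w
  proof -
    define s where "s = 1 + (cmod z)\<^sup>2"
    define t where "t = 1 + (cmod w)\<^sup>2"
    obtain a b where z: "z = Complex a b" by (cases z)
    obtain c d where w: "w = Complex c d" by (cases w)
    have s: "s > 0" and sz: "s = 1 + a\<^sup>2 + b\<^sup>2" "(cmod z)\<^sup>2 = s - 1"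
      using pos[of z] by (auto simp: s_def z cmod_power2)
    have t: "t > 0" and tw: "t = 1 + c\<^sup>2 + d\<^sup>2" "(cmod w)\<^sup>2 = t - 1"
      using pos[of w] by (auto simp: t_def w cmod_power2)
    have 1: "(dist (z / complex_of_real s) (w / complex_of_real t))\<^sup>2
        = (a / s - c / t)\<^sup>2 + (b / s - d / t)\<^sup>2"
      by (simp add: dist_norm cmod_power2 z w)
    have 2: "(dist ((s - 1) / s) ((t - 1) / t))\<^sup>2 = (1 / t - 1 / s)\<^sup>2"
      using s t by (simp add: dist_real_def diff_divide_distrib)
    have 3: "(a / s - c / t)\<^sup>2 + (b / s - d / t)\<^sup>2 + (1 / t - 1 / s)\<^sup>2
        = ((a - c)\<^sup>2 + (b - d)\<^sup>2) / (s * t)"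
    proof -
      have ns: "s \<noteq> 0" "t \<noteq> 0" using s t by auto
      have "a / s - c / t = (a * t - c * s) / (s * t)" "b / s - d / t = (b * t - d * s) / (s * t)"
        "1 / t - 1 / s = (s - t) / (s * t)"
        using ns by (simp_all add: divide_simps)
      then have "(a / s - c / t)\<^sup>2 + (b / s - d / t)\<^sup>2 + (1 / t - 1 / s)\<^sup>2
          = ((a * t - c * s)\<^sup>2 + (b * t - d * s)\<^sup>2 + (s - t)\<^sup>2) / (s * t)\<^sup>2"
        by (simp only: power_divide add_divide_distrib)
      also have "(a * t - c * s)\<^sup>2 + (b * t - d * s)\<^sup>2 + (s - t)\<^sup>2
          = ((a - c)\<^sup>2 + (b - d)\<^sup>2) * (s * t)"
        unfolding sz(1) tw(1) by algebra
      finally show ?thesis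
        using ns by (simp add: power2_eq_square)
    qed
    have 4: "(a - c)\<^sup>2 + (b - d)\<^sup>2 = (cmod (z - w))\<^sup>2"
      by (simp add: cmod_power2 z w)
    have "stereo (Fin z) = (z / complex_of_real s, (s - 1) / s)"
         "stereo (Fin w) = (w / complex_of_real t, (t - 1) / t)"
      by (simp_all add: sz(2) tw(2))
    then have "dist (stereo (Fin z)) (stereo (Fin w)) = sqrt ((cmod (z - w))\<^sup>2 / (s * t))"
      by (simp only: dist_Pair_Pair 1 2 3 4)
    then show ?thesis
      by (simp add: real_sqrt_divide s_def t_def)
  qed
  show ?thesis
    using inf fin by (cases x; cases y) (simp_all only: chordal.simps dist_commute[of "stereo Infty"] dist_self)
qed

lemma stereo_inject: "stereo x = stereo y \<longleftrightarrow> x = y"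
proof
  have pos: "1 + (cmod z)\<^sup>2 > 0" for z
    by (simp add: add_pos_nonneg)
  assume "stereo x = stereo y"
  then have "chordal x y = 0" by (simp add: chordal_eq_dist_stereo)
  then show "x = y"
    using pos by (cases x; cases y) (auto simp: less_imp_neq[symmetric])
qed simp

instantiation csphere :: metric_space
begin

definition dist_csphere :: "csphere \<Rightarrow> csphere \<Rightarrow> real" where
  "dist_csphere = chordal"

definition uniformity_csphere :: "(csphere \<times> csphere) filter" where
  "uniformity_csphere = (INF e\<in>{0 <..}. principal {(x, y). dist x y < e})"

definition open_csphere :: "csphere set \<Rightarrow> bool" where
  "open_csphere S = (\<forall>x\<in>S. \<forall>\<^sub>F (x', y) in uniformity. x' = x \<longrightarrow> y \<in> S)"

instance
proof
  fix x y z :: csphere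
  show "dist x y = 0 \<longleftrightarrow> x = y"
    by (simp add: dist_csphere_def chordal_eq_dist_stereo stereo_inject)
  show "dist x y \<le> dist x z + dist y z"
    by (simp add: dist_csphere_def chordal_eq_dist_stereo dist_triangle2)
qed (simp_all only: uniformity_csphere_def open_csphere_def)

end

definition SL2C :: "(complex^2^2) set" where
  "SL2C = {A. det A = 1}"

fun mobius :: "complex^2^2 \<Rightarrow> csphere \<Rightarrow> csphere" where
  "mobius A (Fin z) =
     (if A$2$1 * z + A$2$2 = 0 then Infty
      else Fin ((A$1$1 * z + A$1$2) / (A$2$1 * z + A$2$2)))"
| "mobius A Infty = (if A$2$1 = 0 then Infty else Fin (A$1$1 / A$2$1))"

(* PSL(2,C), realised as the group of Moebius transformations of the sphere; by
   mobius_eq_iff below this is SL(2,C) modulo sign. *)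
definition PSL2C :: "(csphere \<Rightarrow> csphere) set" where
  "PSL2C = mobius ` SL2C"

lemma mobius_eq_iff:
  assumes "A \<in> SL2C" "B \<in> SL2C"
  shows "mobius A = mobius B \<longleftrightarrow> A = B \<or> A = - B"
proof
  assume eq: "mobius A = mobius B"
  define a b c d where abcd: "a = A$1$1" "b = A$1$2" "c = A$2$1" "d = A$2$2"
  define a' b' c' d' where abcd': "a' = B$1$1" "b' = B$1$2" "c' = B$2$1" "d' = B$2$2"
  have det: "a * d - b * c = 1" "a' * d' - b' * c' = 1"
    using assms by (auto simp: SL2C_def det_2 abcd abcd')
  have e1: "a * c' = a' * c"
    using fun_cong[OF eq, of Infty]
    by (auto simp: abcd[symmetric] abcd'[symmetric] field_simps split: if_splits)
  have ez: "(a * z + b) * (c' * z + d') = (a' * z + b') * (c * z + d)" for z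
    using fun_cong[OF eq, of "Fin z"]
    by (auto simp: abcd[symmetric] abcd'[symmetric] frac_eq_eq split: if_splits)
  have e2: "b * d' = b' * d" using ez[of 0] by simp
  have e3: "a * d' + b * c' = a' * d + b' * c"
    using ez[of 1] e1 e2 by (simp add: algebra_simps)
  define x where "x = a' * d - b * c'"
  have x': "x = a * d' - b' * c" using e3 by (simp add: x_def algebra_simps)
  have "x * x = 1"
  proof -
    have "x * x = (a' * d - b * c') * (a * d' - b' * c)" using x' x_def by simp
    also have "\<dots> = (a * d - b * c) * (a' * d' - b' * c')
        + (a * c' - a' * c) * (b' * d - b * d')"
      by algebra
    finally show ?thesis using det e1 by simp
  qed
  then have x: "x = 1 \<or> x = -1" by (simp add: square_eq_1_iff)
  have "a' = x * a" "b' = x * b" "c' = x * c" "d' = x * d"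
    using det(1) e1 e2 x_def x' by algebra+
  with x have "(a' = a \<and> b' = b \<and> c' = c \<and> d' = d) \<or> (a' = -a \<and> b' = -b \<and> c' = -c \<and> d' = -d)"
    by auto
  then show "A = B \<or> A = - B"
    by (auto simp: vec_eq_iff forall_2 abcd abcd')
next
  have "mobius (- B) y = mobius B y" for y
  proof (cases y)
    case (Fin z)
    have "- (B$2$1 * z) - B$2$2 = - (B$2$1 * z + B$2$2)"
         "- (B$1$1 * z) - B$1$2 = - (B$1$1 * z + B$1$2)" by simp_all
    then have "mobius (- B) (Fin z) = (if - (B$2$1 * z + B$2$2) = 0 then Infty
        else Fin (- (B$1$1 * z + B$1$2) / - (B$2$1 * z + B$2$2)))"
      by simp
    then show ?thesis
      unfolding Fin mobius.simps neg_equal_0_iff_equal minus_divide_divide .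
  qed simp
  then show "A = B \<or> A = - B \<Longrightarrow> mobius A = mobius B" by auto
qed

fun scaling :: "complex \<Rightarrow> csphere \<Rightarrow> csphere" where
  "scaling l (Fin z) = Fin (l * z)"
| "scaling l Infty = Infty"

definition loxodromic :: "(csphere \<Rightarrow> csphere) \<Rightarrow> bool" where
  "loxodromic f \<longleftrightarrow> f \<in> PSL2C \<and>
     (\<exists>h\<in>PSL2C. \<exists>l. l \<noteq> 0 \<and> cmod l \<noteq> 1 \<and> f = inv h \<circ> scaling l \<circ> h)"

(* The coordinate on the sphere minus Infty; its value at Infty is a dummy. *)
fun coord :: "csphere \<Rightarrow> complex" where
  "coord (Fin z) = z"
| "coord Infty = 0"

fun inversion :: "csphere \<Rightarrow> csphere" where
  "inversion (Fin z) = (if z = 0 then Infty else Fin (1 / z))"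
| "inversion Infty = Fin 0"

(* Complex derivative at a fixed point, taken in the coordinate 1/z if the point is Infty. *)
fun has_multiplier :: "(csphere \<Rightarrow> csphere) \<Rightarrow> csphere \<Rightarrow> complex \<Rightarrow> bool" where
  "has_multiplier f (Fin z) D \<longleftrightarrow> ((\<lambda>w. coord (f (Fin w))) has_field_derivative D) (at z)"
| "has_multiplier f Infty D \<longleftrightarrow>
     ((\<lambda>w. coord (inversion (f (inversion (Fin w))))) has_field_derivative D) (at 0)"

definition attracting_fixed_point :: "(csphere \<Rightarrow> csphere) \<Rightarrow> csphere \<Rightarrow> bool" where
  "attracting_fixed_point f p \<longleftrightarrow> f p = p \<and> (\<exists>D. has_multiplier f p D \<and> cmod D < 1)"

definition attracting_basin :: "(csphere \<Rightarrow> csphere) \<Rightarrow> csphere \<Rightarrow> csphere set" where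
  "attracting_basin f p = {x. (\<lambda>n. (f ^^ n) x) \<longlonglongrightarrow> p}"

end

theory Submission
  imports Defs
begin

text \<open>
  In the coordinate \<open>h\<close> the map \<open>f\<close> is the scaling \<open>z \<mapsto> l z\<close> with \<open>0 < \<bar>l\<bar> < 1\<close>, whose fixed points
  are \<open>0\<close> and \<open>\<infinity>\<close> and whose iterates tend to \<open>0\<close> uniformly on every bounded set of the plane.

  The point that needs an argument is \<open>h p = 0\<close>. The multiplier at \<open>p\<close> is not computed; instead
  \<open>attracting_fixed_point_attracts_another_point\<close> shows that an attracting fixed point of an injective
  map draws in some point \<open>y \<noteq> p\<close>. If \<open>h p\<close> were \<open>\<infinity>\<close>, then \<open>h y\<close> would be a finite point, whose orbit
  under the scaling tends to \<open>0\<close> and not to \<open>\<infinity>\<close>. As \<open>\<infinity>\<close> is fixed by the scaling and \<open>h x\<close> is drawn to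
  \<open>0\<close>, the point \<open>h x\<close> is a finite \<open>u\<close>, and the preimage under \<open>h\<close> of the closed unit disc about \<open>u\<close>
  is the required neighbourhood: on the disc the iterates of the scaling tend uniformly to the constant
  \<open>0\<close>, and continuity of \<open>inv h\<close> at that single point transports this to uniform convergence to \<open>p\<close>.

  The topology enters only through the fact that Moebius maps are homeomorphisms for the chordal metric
  (\<open>continuous_on_mobius\<close>, \<open>inv_mobius\<close>).
\<close>

section \<open>The chordal metric in the affine coordinate\<close>

lemma dist_eq_dist_stereo: "dist x y = dist (stereo x) (stereo y)"
  by (simp add: dist_csphere_def chordal_eq_dist_stereo)

lemma dist_Fin_le: "dist (Fin z) (Fin w) \<le> dist z w"
proof -
  have "1 * 1 \<le> (1 + (cmod z)\<^sup>2) * (1 + (cmod w)\<^sup>2)"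
    by (intro mult_mono) auto
  then have "1 \<le> sqrt ((1 + (cmod z)\<^sup>2) * (1 + (cmod w)\<^sup>2))"
    by simp
  then have "cmod (z - w) / sqrt ((1 + (cmod z)\<^sup>2) * (1 + (cmod w)\<^sup>2)) \<le> cmod (z - w) / 1"
    by (intro divide_left_mono) auto
  then show ?thesis
    by (simp add: dist_csphere_def dist_norm)
qed

lemma isCont_Fin: "isCont Fin z"
  unfolding continuous_at_eps_delta using dist_Fin_le le_less_trans by blast

lemma continuous_on_stereo: "continuous_on S stereo"
  unfolding continuous_on_iff by (metis dist_eq_dist_stereo)

text \<open>
  Stereographic projection from the north pole \<open>(0, 1)\<close>. At \<open>\<infinity>\<close> both sides are \<open>0\<close>, the right-hand side
  because of the division by zero.
\<close>

lemma coord_eq_stereo: "coord y = fst (stereo y) / complex_of_real (1 - snd (stereo y))"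
proof (cases y)
  case (Fin z)
  have "1 + (cmod z)\<^sup>2 > 0" by (simp add: add_pos_nonneg)
  then have "1 + (cmod z)\<^sup>2 \<noteq> 0" "1 - (cmod z)\<^sup>2 / (1 + (cmod z)\<^sup>2) = 1 / (1 + (cmod z)\<^sup>2)"
    by (auto simp: field_simps)
  then show ?thesis
    using Fin by (simp only: coord.simps stereo.simps fst_conv snd_conv) (simp del: of_real_add of_real_power)
qed simp

lemma continuous_on_coord: "continuous_on (- {Infty}) coord"
proof -
  have "snd (stereo y) \<noteq> 1" if "y \<noteq> Infty" for y
  proof (cases y)
    case (Fin z)
    have "1 + (cmod z)\<^sup>2 > 0" by (simp add: add_pos_nonneg)
    then show ?thesis using Fin by (simp add: field_simps)
  qed (use that in simp)
  then show ?thesis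
    unfolding coord_eq_stereo[abs_def]
    by (intro continuous_intros continuous_on_stereo) auto
qed

lemma open_Fin_image:
  assumes "open S"
  shows "open (Fin ` S)"
proof -
  have "Fin ` S = coord -` S \<inter> - {Infty}"
  proof (intro equalityI subsetI)
    fix y assume "y \<in> coord -` S \<inter> - {Infty}"
    then show "y \<in> Fin ` S" by (cases y) auto
  qed auto
  then show ?thesis
    using continuous_on_open_vimage[of "- {Infty}" coord] continuous_on_coord assms by auto
qed

text \<open>Continuity at a finite point may be tested in the affine coordinate, where it is a question about
  functions of a complex variable.\<close>

lemma isCont_at_FinI:
  fixes F :: "csphere \<Rightarrow> 'b::topological_space"
  assumes "isCont (\<lambda>w. F (Fin w)) z"
  shows "isCont F (Fin z)"
proof -
  have "isCont coord (Fin z)"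
    using continuous_on_coord continuous_on_eq_continuous_at[of "- {Infty}" coord] by auto
  then have "isCont (\<lambda>y. F (Fin (coord y))) (Fin z)"
    by (rule isCont_o2[where g = "\<lambda>w. F (Fin w)"]) (simp add: assms)
  moreover have "\<forall>\<^sub>F y in nhds (Fin z). F (Fin (coord y)) = F y"
  proof -
    have "\<forall>\<^sub>F y in nhds (Fin z). y \<in> - {Infty}"
      by (intro eventually_nhds_in_open) auto
    then show ?thesis
    proof eventually_elim
      case (elim y)
      then show ?case by (cases y) auto
    qed
  qed
  ultimately show ?thesis
    by (simp add: isCont_cong)
qed

lemma inversion_inversion [simp]: "inversion (inversion y) = y"
  by (cases y) auto

text \<open>On the sphere, inversion is the rotation \<open>(a, b) \<mapsto> (cnj a, 1 - b)\<close>.\<close>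

lemma dist_inversion: "dist (inversion x) (inversion y) = dist x y"
proof -
  have "stereo (inversion y) = (cnj (fst (stereo y)), 1 - snd (stereo y))" for y
  proof (cases y)
    case (Fin z)
    show ?thesis
    proof (cases "z = 0")
      case False
      have s: "1 + (cmod z)\<^sup>2 > 0" by (simp add: add_pos_nonneg)
      have r: "1 + (cmod (1 / z))\<^sup>2 = (1 + (cmod z)\<^sup>2) / (cmod z)\<^sup>2"
        using False by (simp add: norm_divide field_simps)
      have "1 / z / complex_of_real (1 + (cmod (1 / z))\<^sup>2)
          = (complex_of_real ((cmod z)\<^sup>2) / z) / complex_of_real (1 + (cmod z)\<^sup>2)"
        unfolding r by (simp add: field_simps)
      also have "complex_of_real ((cmod z)\<^sup>2) / z = cnj z"
        using False by (simp add: complex_norm_square del: of_real_power)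
      finally have "1 / z / complex_of_real (1 + (cmod (1 / z))\<^sup>2)
          = cnj (z / complex_of_real (1 + (cmod z)\<^sup>2))"
        by simp
      moreover have "(cmod (1 / z))\<^sup>2 / (1 + (cmod (1 / z))\<^sup>2) = 1 - (cmod z)\<^sup>2 / (1 + (cmod z)\<^sup>2)"
        unfolding r using False s by (simp add: norm_divide field_simps)
      ultimately show ?thesis using Fin False
        by (simp only: inversion.simps stereo.simps if_False fst_conv snd_conv)
    qed (use Fin in simp)
  qed simp
  then show ?thesis
    by (simp add: dist_eq_dist_stereo dist_prod_def dist_norm abs_minus_commute
        flip: complex_cnj_diff)
qed

lemma continuous_on_inversion: "continuous_on S inversion"
  unfolding continuous_on_iff by (metis dist_inversion)

section \<open>Moebius maps are homeomorphisms\<close>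

lemma mobius_mult:
  assumes "det B \<noteq> 0"
  shows "mobius (A ** B) y = mobius A (mobius B y)"
proof -
  \<comment> \<open>The point with homogeneous coordinates \<open>(s : t)\<close>, on which a Moebius map acts linearly.\<close>
  define q where "q s t = (if t = 0 then Infty else Fin (s / t))" for s t :: complex
  have mobius_q: "mobius M (q s t) = q (M$1$1 * s + M$1$2 * t) (M$2$1 * s + M$2$2 * t)"
    if "s \<noteq> 0 \<or> t \<noteq> 0" for M s t
  proof (cases "t = 0")
    case False
    have "M$i$1 * (s / t) + M$i$2 = (M$i$1 * s + M$i$2 * t) / t" for i
      using False by (simp add: field_simps)
    then have "mobius M (Fin (s / t)) = (if (M$2$1 * s + M$2$2 * t) / t = 0 then Infty
        else Fin (((M$1$1 * s + M$1$2 * t) / t) / ((M$2$1 * s + M$2$2 * t) / t)))"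
      by (simp only: mobius.simps)
    then show ?thesis
      using False by (simp add: q_def del: mobius.simps)
  qed (use that in \<open>simp add: q_def\<close>)
  obtain s t where y: "y = q s t" and st: "s \<noteq> 0 \<or> t \<noteq> 0"
  proof (cases y)
    case (Fin z)
    then show thesis using that[of z 1] by (simp add: q_def)
  next
    case Infty
    then show thesis using that[of 1 0] by (simp add: q_def)
  qed
  have "B$1$1 * s + B$1$2 * t \<noteq> 0 \<or> B$2$1 * s + B$2$2 * t \<noteq> 0"
  proof (rule ccontr)
    assume "\<not> ?thesis"
    then have "B$1$1 * s + B$1$2 * t = 0" "B$2$1 * s + B$2$2 * t = 0" by auto
    then have "(B$1$1 * B$2$2 - B$1$2 * B$2$1) * s = 0" "(B$1$1 * B$2$2 - B$1$2 * B$2$1) * t = 0"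
      by algebra+
    then show False using st assms by (auto simp: det_2)
  qed
  moreover have "(A ** B)$i$1 * s + (A ** B)$i$2 * t
      = A$i$1 * (B$1$1 * s + B$1$2 * t) + A$i$2 * (B$2$1 * s + B$2$2 * t)" for i
    by (simp add: matrix_matrix_mult_def sum_2 algebra_simps)
  ultimately show ?thesis
    by (simp only: y mobius_q st simp_thms)
qed

lemma mobius_one: "mobius (mat 1) y = y"
  by (cases y) (auto simp: mat_def)

lemma inversion_eq_mobius: "inversion = mobius (vector [vector [0, 1], vector [1, 0]])"
proof
  show "inversion y = mobius (vector [vector [0, 1], vector [1, 0]]) y" for y
    by (cases y) auto
qed

lemma continuous_on_mobius:
  assumes "det A \<noteq> 0"
  shows "continuous_on S (mobius A)"
proof -
  define J :: "complex^2^2" where "J = vector [vector [0, 1], vector [1, 0]]"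
  have J: "det J \<noteq> 0" "mobius J = inversion"
    by (simp_all add: J_def det_2 inversion_eq_mobius)
  have inv: "isCont inversion y" for y
    using continuous_on_inversion[of UNIV] by (simp add: continuous_on_eq_continuous_at)
  have finite_value: "isCont (mobius A) (Fin z)" if "A$2$1 * z + A$2$2 \<noteq> 0" for A z
  proof (rule isCont_at_FinI)
    have "isCont (\<lambda>w. A$2$1 * w + A$2$2) z" by (intro continuous_intros)
    then have "\<forall>\<^sub>F w in nhds z. A$2$1 * w + A$2$2 \<noteq> 0"
      using that by (metis isCont_def tendsto_at_iff_tendsto_nhds tendsto_imp_eventually_ne)
    then have "\<forall>\<^sub>F w in nhds z. mobius A (Fin w)
        = Fin ((A$1$1 * w + A$1$2) / (A$2$1 * w + A$2$2))"
      by eventually_elim simp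
    moreover have "isCont (\<lambda>w. Fin ((A$1$1 * w + A$1$2) / (A$2$1 * w + A$2$2))) z"
      using that by (intro isCont_o2[OF _ isCont_Fin] continuous_intros)
    ultimately show "isCont (\<lambda>w. mobius A (Fin w)) z"
      by (simp add: isCont_cong del: mobius.simps)
  qed
  \<comment> \<open>A pole is moved to a zero by inverting the value, and \<open>\<infinity>\<close> is moved to \<open>0\<close> by inverting the
    argument.\<close>
  have finite_point: "isCont (mobius A) (Fin z)" if A: "det A \<noteq> 0" for A z
  proof (cases "A$2$1 * z + A$2$2 = 0")
    case True
    have "A$1$1 * z + A$1$2 \<noteq> 0"
    proof
      assume "A$1$1 * z + A$1$2 = 0"
      with True have "A$1$1 * A$2$2 - A$1$2 * A$2$1 = 0" by algebra
      then show False using A by (simp add: det_2)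
    qed
    then have "isCont (mobius (J ** A)) (Fin z)"
      by (intro finite_value) (simp add: matrix_matrix_mult_def sum_2 J_def)
    then have "isCont (\<lambda>y. inversion (mobius (J ** A) y)) (Fin z)"
      by (rule isCont_o2) (rule inv)
    moreover have "inversion (mobius (J ** A) y) = mobius A y" for y
      using mobius_mult[OF A, of J y] J(2) by simp
    ultimately show ?thesis by simp
  qed (rule finite_value)
  have "isCont (mobius A) y" for y
  proof (cases y)
    case Infty
    have "det (A ** J) \<noteq> 0" using assms J(1) by (simp add: det_mul)
    then have "isCont (mobius (A ** J)) (inversion Infty)"
      by (simp add: finite_point)
    then have "isCont (\<lambda>y. mobius (A ** J) (inversion y)) Infty"
      by (rule isCont_o2[OF inv])
    moreover have "mobius (A ** J) (inversion y) = mobius A y" for y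
      using mobius_mult[OF J(1), of A "inversion y"] J(2) by simp
    ultimately show ?thesis using Infty by simp
  qed (simp add: finite_point assms)
  then show ?thesis
    by (simp add: continuous_at_imp_continuous_on)
qed

lemma inv_mobius:
  assumes "det A \<noteq> 0"
  obtains B where "det B \<noteq> 0" "bij (mobius A)" "inv (mobius A) = mobius B"
proof -
  obtain B where AB: "A ** B = mat 1" "B ** A = mat 1"
    using assms invertible_det_nz[of A] unfolding invertible_def by blast
  have B: "det B \<noteq> 0"
    using arg_cong[OF AB(1), of det] by (auto simp: det_mul)
  have l: "mobius B (mobius A y) = y" and r: "mobius A (mobius B y) = y" for y
    using mobius_mult[OF assms, of B y] mobius_mult[OF B, of A y]
    by (simp_all only: AB mobius_one)
  have "bij (mobius A)" by (rule o_bij[of "mobius B"]) (auto simp: l r fun_eq_iff)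
  moreover have "inv (mobius A) = mobius B" by (rule inv_equality) (auto simp: l r)
  ultimately show thesis using that B by blast
qed

lemma PSL2C_homeomorphism:
  assumes "h \<in> PSL2C"
  shows "bij h" "continuous_on UNIV h" "continuous_on UNIV (inv h)"
proof -
  obtain A where A: "h = mobius A" "det A \<noteq> 0"
    using assms by (auto simp: PSL2C_def SL2C_def)
  obtain B where "det B \<noteq> 0" "bij h" "inv h = mobius B"
    using inv_mobius[OF A(2)] A(1) by metis
  then show "bij h" "continuous_on UNIV h" "continuous_on UNIV (inv h)"
    using A by (simp_all add: continuous_on_mobius)
qed

section \<open>Iterates\<close>

lemma funpow_scaling_Fin: "(scaling l ^^ n) (Fin z) = Fin (l ^ n * z)"
  by (induction n) (auto simp: algebra_simps)

lemma funpow_scaling_Infty: "(scaling l ^^ n) Infty = Infty"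
  by (induction n) auto

lemma funpow_scaling_tendsto:
  assumes "cmod l < 1"
  shows "(\<lambda>n. (scaling l ^^ n) (Fin z)) \<longlonglongrightarrow> Fin 0"
proof -
  have "(\<lambda>n. l ^ n * z) \<longlonglongrightarrow> 0 * z"
    using assms by (intro tendsto_intros LIMSEQ_power_zero)
  then show ?thesis
    unfolding funpow_scaling_Fin using isCont_tendsto_compose[OF isCont_Fin[of 0]] by simp
qed

lemma funpow_conj:
  assumes "\<And>y. k (h y) = y" "\<And>y. h (k y) = y"
  shows "(k \<circ> g \<circ> h) ^^ n = k \<circ> (g ^^ n) \<circ> h"
  using assms by (induction n) (auto simp: fun_eq_iff)

section \<open>Attracting fixed points\<close>

text \<open>
  With \<open>\<bar>D\<bar> < c < 1\<close> the map contracts distances to \<open>z\<close> by the factor \<open>c\<close> near \<open>z\<close>. Injectivity is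
  used to shrink this neighbourhood so that it contains no preimage of \<open>\<infinity>\<close>: there the coordinate of the
  image says nothing about the image itself.
\<close>

lemma attracting_Fin_attracts_another_point:
  assumes "inj F" and fixed: "F (Fin z) = Fin z"
    and "has_multiplier F (Fin z) D" and "cmod D < 1"
  shows "\<exists>y. y \<noteq> Fin z \<and> (\<lambda>n. (F ^^ n) y) \<longlonglongrightarrow> Fin z"
proof -
  define \<phi> where "\<phi> w = coord (F (Fin w))" for w
  have \<phi>z: "\<phi> z = z" by (simp add: \<phi>_def fixed)
  obtain c where c: "cmod D < c" "c < 1" using assms(4) dense by blast
  then have "0 \<le> c" using norm_ge_zero[of D] by linarith
  have "(\<phi> has_field_derivative D) (at z)"
    using assms(3) by (simp add: \<phi>_def[abs_def])
  then have "((\<lambda>w. (\<phi> w - z) / (w - z)) \<longlongrightarrow> D) (at z)"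
    by (simp add: has_field_derivative_iff \<phi>z)
  then have "\<forall>\<^sub>F w in at z. cmod ((\<phi> w - z) / (w - z)) < c"
    using order_tendstoD(2)[OF tendsto_norm c(1)] by blast
  moreover have "\<forall>\<^sub>F w in at z. F (Fin w) \<noteq> Infty"
  proof (cases "\<exists>v. F (Fin v) = Infty")
    case True
    then obtain v where v: "F (Fin v) = Infty" by blast
    then have "z \<noteq> v" using fixed by auto
    then have "\<forall>\<^sub>F w in at z. w \<noteq> v"
      by (rule tendsto_imp_eventually_ne[OF tendsto_ident_at])
    then show ?thesis
    proof eventually_elim
      case (elim w)
      then show ?case using v injD[OF assms(1), of "Fin w" "Fin v"] by auto
    qed
  qed auto
  ultimately have "\<forall>\<^sub>F w in at z. cmod ((\<phi> w - z) / (w - z)) < c \<and> F (Fin w) \<noteq> Infty"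
    by eventually_elim simp
  then obtain r where r: "r > 0"
    and near: "\<And>w. w \<noteq> z \<Longrightarrow> dist w z < r \<Longrightarrow> cmod ((\<phi> w - z) / (w - z)) < c \<and> F (Fin w) \<noteq> Infty"
    unfolding eventually_at by auto
  have step: "F (Fin w) = Fin (\<phi> w) \<and> cmod (\<phi> w - z) \<le> c * cmod (w - z)" if "dist w z < r" for w
  proof (cases "w = z")
    case False
    with near[OF False that] show ?thesis
      by (cases "F (Fin w)") (auto simp: \<phi>_def norm_divide divide_simps)
  qed (simp add: fixed \<phi>z)
  define w where "w = z + of_real (r / 2)"
  have w: "w \<noteq> z" "cmod (w - z) < r" using r by (simp_all add: w_def)
  have orbit: "\<exists>v. (F ^^ n) (Fin w) = Fin v \<and> cmod (v - z) \<le> c ^ n * cmod (w - z)" for n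
  proof (induction n)
    case (Suc n)
    then obtain v where v: "(F ^^ n) (Fin w) = Fin v" "cmod (v - z) \<le> c ^ n * cmod (w - z)"
      by blast
    have "c ^ n * cmod (w - z) \<le> 1 * cmod (w - z)"
      using \<open>0 \<le> c\<close> c(2) by (intro mult_right_mono power_le_one) auto
    then have "dist v z < r" using v(2) w(2) by (simp add: dist_norm)
    moreover have "c * cmod (v - z) \<le> c ^ Suc n * cmod (w - z)"
      using mult_left_mono[OF v(2) \<open>0 \<le> c\<close>] by (simp add: mult.assoc)
    ultimately show ?case using step[of v] v(1) by fastforce
  qed simp
  have "(\<lambda>n. (F ^^ n) (Fin w)) \<longlonglongrightarrow> Fin z"
  proof (rule metric_tendsto_imp_tendsto)
    have "(\<lambda>n. c ^ n * cmod (w - z)) \<longlonglongrightarrow> 0 * cmod (w - z)"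
      using \<open>0 \<le> c\<close> c(2) by (intro tendsto_intros LIMSEQ_power_zero) simp
    then show "(\<lambda>n. c ^ n * cmod (w - z)) \<longlonglongrightarrow> 0" by simp
    have "dist ((F ^^ n) (Fin w)) (Fin z) \<le> c ^ n * cmod (w - z)" for n
      using orbit[of n] dist_Fin_le[of _ z] by (metis dist_norm order_trans)
    then show "\<forall>\<^sub>F n in sequentially.
        dist ((F ^^ n) (Fin w)) (Fin z) \<le> dist (c ^ n * cmod (w - z)) 0"
      using \<open>0 \<le> c\<close> by (simp add: dist_norm)
  qed
  then show ?thesis using w(1) by blast
qed

lemma attracting_fixed_point_attracts_another_point:
  assumes "inj F" "attracting_fixed_point F p"
  shows "\<exists>y. y \<noteq> p \<and> (\<lambda>n. (F ^^ n) y) \<longlonglongrightarrow> p"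
proof (cases p)
  case (Fin z)
  then show ?thesis
    using assms attracting_Fin_attracts_another_point unfolding attracting_fixed_point_def by blast
next
  case Infty
  define G where "G = inversion \<circ> F \<circ> inversion"
  obtain D where D: "F Infty = Infty" "has_multiplier F Infty D" "cmod D < 1"
    using assms(2) Infty by (auto simp: attracting_fixed_point_def)
  have "inj G"
    unfolding G_def by (intro inj_compose assms(1)) (metis injI inversion_inversion)+
  moreover have "G (Fin 0) = Fin 0" by (simp add: G_def D(1))
  moreover have "has_multiplier G (Fin 0) D" using D(2) by (simp add: G_def)
  ultimately obtain y where y: "y \<noteq> Fin 0" "(\<lambda>n. (G ^^ n) y) \<longlonglongrightarrow> Fin 0"
    using attracting_Fin_attracts_another_point D(3) by blast
  have "(\<lambda>n. inversion ((G ^^ n) y)) \<longlonglongrightarrow> inversion (Fin 0)"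
    using continuous_on_tendsto_compose[OF continuous_on_inversion[of UNIV] y(2)] by simp
  then have "(\<lambda>n. (F ^^ n) (inversion y)) \<longlonglongrightarrow> Infty"
    by (simp add: G_def funpow_conj)
  moreover have "inversion y \<noteq> Infty" using y(1) by (metis inversion.simps(2) inversion_inversion)
  ultimately show ?thesis using Infty by blast
qed

section \<open>Uniform convergence near a point of the basin\<close>

text \<open>Because the limit is constant, all values to which \<open>k\<close> is applied are eventually close to the one
  point \<open>a\<close>, so one \<open>\<delta>\<close> from continuity at \<open>a\<close> serves the whole of \<open>S\<close>.\<close>

lemma uniform_limit_const_compose:
  fixes k :: "'a::metric_space \<Rightarrow> 'b::metric_space"
  assumes "uniform_limit S F (\<lambda>_. a) net" "isCont k a"
  shows "uniform_limit S (\<lambda>n y. k (F n y)) (\<lambda>_. k a) net"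
proof (rule uniform_limitI)
  fix e :: real assume "0 < e"
  then obtain d where d: "d > 0" "\<And>b. dist b a < d \<Longrightarrow> dist (k b) (k a) < e"
    using assms(2) unfolding continuous_at_eps_delta by blast
  from uniform_limitD[OF assms(1) d(1)]
  show "\<forall>\<^sub>F n in net. \<forall>y\<in>S. dist (k (F n y)) (k a) < e"
    by eventually_elim (use d(2) in blast)
qed

lemma uniform_limit_funpow_scaling:
  assumes "cmod l < 1" "bounded S"
  shows "uniform_limit (Fin ` S) (\<lambda>n. scaling l ^^ n) (\<lambda>_. Fin 0) sequentially"
proof (rule uniform_limitI)
  fix e :: real assume "0 < e"
  obtain M where M: "\<And>z. z \<in> S \<Longrightarrow> cmod z \<le> M"
    using assms(2) by (auto simp: bounded_iff)
  have "(\<lambda>n. cmod l ^ n * M) \<longlonglongrightarrow> 0 * M"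
    using assms(1) by (intro tendsto_intros LIMSEQ_power_zero) simp
  then have "\<forall>\<^sub>F n in sequentially. cmod l ^ n * M < e"
    using order_tendstoD(2) \<open>0 < e\<close> by fastforce
  then show "\<forall>\<^sub>F n in sequentially. \<forall>y\<in>Fin ` S. dist ((scaling l ^^ n) y) (Fin 0) < e"
  proof eventually_elim
    case (elim n)
    have "dist (Fin (l ^ n * z)) (Fin 0) < e" if "z \<in> S" for z
    proof -
      have "dist (Fin (l ^ n * z)) (Fin 0) \<le> cmod l ^ n * cmod z"
        using dist_Fin_le[of "l ^ n * z" 0] by (simp add: norm_mult norm_power)
      also have "\<dots> \<le> cmod l ^ n * M" using M[OF that] by (simp add: mult_left_mono)
      finally show ?thesis using elim by simp
    qed
    then show ?case by (auto simp: funpow_scaling_Fin)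
  qed
qed

theorem lemma3p2:
  fixes A :: "complex^2^2" and f g h :: "csphere \<Rightarrow> csphere"
    and p x :: csphere and l :: complex
  assumes "A \<in> SL2C" and "f = mobius A" and "loxodromic f"
    and "attracting_fixed_point f p"
    and "x \<in> attracting_basin f p"
    and "h \<in> PSL2C"
    and "g = scaling l" and "0 < cmod l" and "cmod l < 1"
    and "f = inv h \<circ> g \<circ> h"
  shows "\<exists>K. compact K \<and> x \<in> interior K \<and>
           (\<forall>n. restrict (f ^^ n) K = restrict (inv h \<circ> (g ^^ n) \<circ> h) K) \<and>
           uniform_limit K (\<lambda>n. f ^^ n) (\<lambda>_. p) sequentially"
proof -
  note h = PSL2C_homeomorphism[OF \<open>h \<in> PSL2C\<close>]
  have hinv [simp]: "h (inv h y) = y" "inv h (h y) = y" for y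
    using h(1) by (simp_all add: bij_is_surj surj_f_inv_f bij_is_inj)
  have iter: "f ^^ n = inv h \<circ> (g ^^ n) \<circ> h" for n
    unfolding assms(10) by (rule funpow_conj) simp_all
  \<comment> \<open>Convergence of an \<open>f\<close>-orbit to \<open>p\<close>, seen in the coordinate \<open>h\<close>.\<close>
  have conj_lim: "(\<lambda>n. (g ^^ n) (h y)) \<longlonglongrightarrow> h p" if "(\<lambda>n. (f ^^ n) y) \<longlonglongrightarrow> p" for y
    using continuous_on_tendsto_compose[OF h(2) that] by (simp add: iter)
  have "f p = p" using assms(4) by (simp add: attracting_fixed_point_def)
  have hp: "h p = Fin 0"
  proof -
    have "inj f"
      using PSL2C_homeomorphism(1)[of f] assms(1,2) by (auto simp: PSL2C_def bij_is_inj)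
    then obtain y where y: "y \<noteq> p" "(\<lambda>n. (f ^^ n) y) \<longlonglongrightarrow> p"
      using attracting_fixed_point_attracts_another_point assms(4) by blast
    show ?thesis
    proof (cases "h y")
      case (Fin z)
      then show ?thesis
        using conj_lim[OF y(2)] funpow_scaling_tendsto[OF assms(9)] LIMSEQ_unique
        by (metis assms(7))
    next
      case Infty
      \<comment> \<open>Then \<open>h p\<close> is a finite fixed point of the scaling.\<close>
      then obtain u where u: "h p = Fin u"
        using y(1) hinv(2) by (metis csphere.exhaust)
      have "h p = g (h p)" using \<open>f p = p\<close> assms(10) by (metis comp_apply hinv(1))
      then have "u = l * u" using u assms(7) by simp
      then show ?thesis using u assms(9) by auto
    qed
  qed
  have "h x \<noteq> Infty"
  proof
    assume "h x = Infty"
    then have "(\<lambda>n. Infty) \<longlonglongrightarrow> Fin 0"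
      using conj_lim[of x] assms(5) hp by (simp add: attracting_basin_def assms(7) funpow_scaling_Infty)
    then show False using LIMSEQ_unique tendsto_const by blast
  qed
  then obtain u where u: "h x = Fin u" by (cases "h x") auto
  define K where "K = inv h ` Fin ` cball u 1"
  have hK: "h ` K = Fin ` cball u 1" by (simp add: K_def image_image)
  have "compact K"
    unfolding K_def
    by (intro compact_continuous_image continuous_on_subset[OF h(3)]
        continuous_at_imp_continuous_on ballI isCont_Fin) auto
  moreover have "x \<in> interior K"
  proof (rule interiorI)
    show "open (h -` Fin ` ball u 1)"
      using h(2) by (intro open_vimage open_Fin_image) auto
    show "x \<in> h -` Fin ` ball u 1" using u by simp
    show "h -` Fin ` ball u 1 \<subseteq> K"
    proof
      fix y assume "y \<in> h -` Fin ` ball u 1"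
      then have "h y \<in> Fin ` cball u 1" by auto
      then show "y \<in> K" unfolding K_def by (metis hinv(2) imageI)
    qed
  qed
  moreover have "uniform_limit K (\<lambda>n. f ^^ n) (\<lambda>_. p) sequentially"
  proof -
    have "uniform_limit (h ` K) (\<lambda>n. g ^^ n) (\<lambda>_. Fin 0) sequentially"
      unfolding hK assms(7) by (intro uniform_limit_funpow_scaling assms(9)) simp
    then have "uniform_limit K (\<lambda>n y. (g ^^ n) (h y)) (\<lambda>_. Fin 0) sequentially"
      by (rule uniform_limit_compose') auto
    moreover have "isCont (inv h) (Fin 0)"
      using h(3) by (simp add: continuous_on_eq_continuous_at)
    ultimately have "uniform_limit K (\<lambda>n y. inv h ((g ^^ n) (h y))) (\<lambda>_. inv h (Fin 0)) sequentially"
      by (rule uniform_limit_const_compose)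
    moreover have "inv h (Fin 0) = p" using hp hinv(2) by metis
    ultimately show ?thesis by (simp add: iter comp_def)
  qed
  ultimately show ?thesis using iter by auto
qed

end
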